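(* Let $p$ be an odd prime and $m\in\mathbb Z_p$ with $m\not\equiv0,1\pmod p$. Then $$\sum_{k=0}^{p-1}\frac{a_k}{m^k}\equiv\begin{cases}\displaystyle\sum_{k=0}^{p-1}\frac{\binom{2k}k\binom{3k}k}{((m-3)^3/(m-1))^k}\pmod p&\text{if }m\not\equiv3\pmod p,\\ \displaystyle\sum_{k=0}^{p-1}\frac{\binom{2k}k\binom{3k}k}{((m+3)^3/(m-1)^2)^k}\pmod p&\text{if }m\not\equiv-3\pmod p,\end{cases}$$ and $$\sum_{k=0}^{p-1}\frac{Q_k}{(-8m)^k}\equiv\begin{cases}\displaystyle\sum_{k=0}^{p-1}\frac{\binom{2k}k\binom{3k}k}{((4m-3)^3/(m-1))^k}\pmod p&\text{if }m\not\equiv\frac34\pmod p,\\ \displaystyle\sum_{k=0}^{p-1}\frac{\binom{2k}k\binom{3k}k}{(-(2m-3)^3/(m-1)^2)^k}\pmod p&\text{if }m\not\equiv\frac32\pmod p.\end{cases}$$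
   Context: $f_n=\sum_{k=0}^n\binom nk^3$ (Franel numbers), $a_n=\sum_{k=0}^n\binom nk^2\binom{2k}k$, $Q_n=\sum_{k=0}^n\binom nk(-8)^{n-k}f_k$. $\mathbb Z_p$: rationals with denominator prime to $p$; congruences mod $p$ are in $\mathbb Z_p$. *)

theory Defs
  imports Complex_Main "HOL-Computational_Algebra.Primes"
begin

definition franel :: "nat \<Rightarrow> nat" where
  "franel n = (\<Sum>k=0..n. (n choose k) ^ 3)"

definition a_seq :: "nat \<Rightarrow> nat" where
  "a_seq n = (\<Sum>k=0..n. (n choose k)\<^sup>2 * ((2 * k) choose k))"

definition Q_seq :: "nat \<Rightarrow> int" where
  "Q_seq n = (\<Sum>k=0..n. int (n choose k) * (- 8) ^ (n - k) * int (franel k))"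

text \<open>The ring of rationals whose reduced denominator is prime to \<open>p\<close> (not the \<open>p\<close>-adic
  completion); \<^const>\<open>quotient_of\<close> returns the fraction in lowest terms.\<close>

definition Zp :: "nat \<Rightarrow> rat set" where
  "Zp p = {x. coprime (snd (quotient_of x)) (int p)}"

text \<open>Congruence modulo \<open>p\<close> in \<^term>\<open>Zp p\<close>. Both sides are required to lie in \<^term>\<open>Zp p\<close>, so
  a positive congruence also asserts \<open>p\<close>-integrality; a negated one means incongruence only
  when both sides are known to be in \<^term>\<open>Zp p\<close>.\<close>

definition zp_cong :: "nat \<Rightarrow> rat \<Rightarrow> rat \<Rightarrow> bool" where
  "zp_cong p x y \<longleftrightarrow> x \<in> Zp p \<and> y \<in> Zp p \<and> (\<exists>z\<in>Zp p. x - y = of_nat p * z)"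

end

theory Submission
  imports Defs "HOL-Number_Theory.Residues"
begin

text \<open>
  Write \<open>u\<^sub>k = (2k choose k) (3k choose k)\<close>. The Franel numbers \<open>f\<^sub>n\<close> satisfy both
  \<open>f\<^sub>n = \<Sum>\<^sub>k u\<^sub>k (n+k choose 3k) 2^(n-2k)\<close> (MacMahon) and
  \<open>f\<^sub>n = \<Sum>\<^sub>k u\<^sub>k (n+2k choose 3k) (-4)^(n-k)\<close>, because both sums obey the same second-order
  recurrence. For \<open>s \<le> i < p\<close> the truncated sum \<open>\<Sum>\<^sub>n (n+s choose i) y^n\<close> over \<open>n < p\<close> is congruent
  to \<open>y^(i-s) (1-y)^(p-1-i)\<close>, hence to \<open>y^(i-s) / (1-y)^i\<close> by Fermat when \<open>1 - y\<close> is a unit. As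
  \<open>p\<close> divides \<open>u\<^sub>k\<close> when \<open>p \<le> 3k\<close> and \<open>k < p\<close>, this yields
  \<open>\<Sum> f\<^sub>n z^n \<equiv> \<Sum> u\<^sub>k (z^2 / (1-2z)^3)^k\<close> and \<open>\<Sum> f\<^sub>n z^n \<equiv> \<Sum> u\<^sub>k (z / (1+4z)^3)^k\<close>. Finally \<open>a\<^sub>n\<close> and
  \<open>Q\<^sub>n / (-8)^n\<close> are the binomial transforms of \<open>f\<^sub>n\<close> and \<open>f\<^sub>n / (-8)^n\<close>, so the same principle reduces
  the two sums to \<open>\<Sum> f\<^sub>n z^n\<close> at \<open>z = 1/(m-1)\<close> and at \<open>z = -1/(8(m-1))\<close>.
\<close>

section \<open>Binomial identities\<close>

text \<open>Trinomial revision in a form without side condition: if \<open>j + l > n\<close>, then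
  \<open>n choose j\<close> or \<open>(n - j) choose l\<close> is 0, also under truncated
  subtraction.\<close>

lemma choose_add_mult:
  "(n choose (j + l)) * ((j + l) choose j) = (n choose j) * ((n - j) choose l)"
proof (cases "j + l \<le> n")
  case True
  then show ?thesis using choose_mult[of j "j + l" n] by simp
next
  case False
  then show ?thesis by (cases "j \<le> n") (auto simp: binomial_eq_0)
qed

text \<open>Vandermonde's convolution after reflecting \<open>a choose l\<close> to
  \<open>a choose (a - l)\<close>.\<close>

lemma sum_choose_mult_choose:
  "(\<Sum>l\<le>a. (a choose l) * (b choose l)) = ((a + b) choose a)"
proof -
  have "(\<Sum>l\<le>a. (a choose l) * (b choose l)) = (\<Sum>l\<le>a. (b choose l) * (a choose (a - l)))"
    by (intro sum.cong refl) (simp flip: binomial_symmetric)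
  also have "\<dots> = ((b + a) choose a)" by (rule vandermonde)
  finally show ?thesis by (simp add: add.commute)
qed

lemma sum_atMost_from:
  fixes g :: "nat \<Rightarrow> 'a::comm_monoid_add"
  assumes "j \<le> n" "\<And>k. k < j \<Longrightarrow> g k = 0"
  shows "(\<Sum>k\<le>n. g k) = (\<Sum>l\<le>n - j. g (j + l))"
proof -
  have "(\<Sum>k\<le>n. g k) = (\<Sum>k\<in>{j..n}. g k)"
    using assms by (intro sum.mono_neutral_right) auto
  also have "\<dots> = (\<Sum>l\<le>n - j. g (j + l))"
    using assms(1)
    by (intro sum.reindex_bij_witness[of _ "\<lambda>l. j + l" "\<lambda>k. k - j"]) auto
  finally show ?thesis .
qed

text \<open>Strehl's identity. Vandermonde splits \<open>(2 * j) choose n\<close> into products with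
  lower indices \<open>i\<close> and \<open>n - i\<close>. For fixed \<open>i\<close>, trinomial
  revision pulls out the square of \<open>n choose i\<close>, and the remaining sum over
  \<open>j\<close> is again a Vandermonde sum, which supplies the third factor.\<close>

lemma franel_eq_sum_sq:
  "franel n = (\<Sum>j\<le>n. (n choose j)\<^sup>2 * ((2 * j) choose n))"
proof -
  \<comment> \<open>With \<open>n - j\<close> in place of \<open>j - i\<close>, the revisions at
    \<open>i\<close> and at \<open>n - i\<close> end in the same lower index. For
    \<open>i > j\<close> both sides vanish.\<close>
  have tri: "(n choose j) * (j choose i) = (n choose i) * ((n - i) choose (n - j))"
    if "i \<le> n" "j \<le> n" for i j
  proof (cases "i \<le> j")
    case True
    then show ?thesis
      using that choose_mult[of i j n] binomial_symmetric[of "j - i" "n - i"] by simp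
  next
    case False
    then show ?thesis using that by (simp add: binomial_eq_0)
  qed
  have inner: "(\<Sum>j\<le>n. (n choose j)\<^sup>2 * ((j choose i) * (j choose (n - i)))) = (n choose i) ^ 3"
    if "i \<le> n" for i
  proof -
    have "(\<Sum>j\<le>n. (n choose j)\<^sup>2 * ((j choose i) * (j choose (n - i))))
        = (\<Sum>j\<le>n. (n choose i)\<^sup>2 * (((n - i) choose (n - j)) * (i choose (n - j))))"
    proof (intro sum.cong refl)
      fix j assume "j \<in> {..n}"
      then have j: "j \<le> n" by simp
      have "(n choose j)\<^sup>2 * ((j choose i) * (j choose (n - i)))
          = ((n choose j) * (j choose i)) * ((n choose j) * (j choose (n - i)))"
        by (simp add: power2_eq_square)
      also have "\<dots> = (n choose i)\<^sup>2 * (((n - i) choose (n - j)) * (i choose (n - j)))"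
        using that j tri[of i j] tri[of "n - i" j] binomial_symmetric[of i n]
        by (simp add: power2_eq_square)
      finally show "(n choose j)\<^sup>2 * ((j choose i) * (j choose (n - i))) = \<dots>" .
    qed
    also have "\<dots> = (n choose i)\<^sup>2 * (\<Sum>j\<le>n. ((n - i) choose (n - j)) * (i choose (n - j)))"
      by (simp add: sum_distrib_left)
    also have "(\<Sum>j\<le>n. ((n - i) choose (n - j)) * (i choose (n - j)))
        = (\<Sum>l\<le>n. ((n - i) choose l) * (i choose l))"
      by (intro sum.reindex_bij_witness[of _ "\<lambda>l. n - l" "\<lambda>l. n - l"]) auto
    also have "\<dots> = (\<Sum>l\<le>i. (i choose l) * ((n - i) choose l))"
      using that by (intro sum.mono_neutral_cong_right) (auto simp: binomial_eq_0)
    also have "\<dots> = (n choose i)"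
      using that sum_choose_mult_choose[of i "n - i"] by simp
    finally show ?thesis by (simp add: power2_eq_square power3_eq_cube)
  qed
  have "(\<Sum>j\<le>n. (n choose j)\<^sup>2 * ((2 * j) choose n))
      = (\<Sum>j\<le>n. \<Sum>i\<le>n. (n choose j)\<^sup>2 * ((j choose i) * (j choose (n - i))))"
    unfolding sum_distrib_left[symmetric] vandermonde by (simp only: mult_2)
  also have "\<dots> = (\<Sum>i\<le>n. \<Sum>j\<le>n. (n choose j)\<^sup>2 * ((j choose i) * (j choose (n - i))))"
    by (rule sum.swap)
  also have "\<dots> = (\<Sum>i\<le>n. (n choose i) ^ 3)"
    by (intro sum.cong refl inner) simp
  finally show ?thesis by (simp add: franel_def atLeast0AtMost)
qed

text \<open>Insert Strehl's form of \<open>franel k\<close> and exchange the sums. Two trinomial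
  revisions, at \<open>n\<close> and at \<open>2 * j\<close>, free all factors that depend on
  \<open>j\<close> alone, and a Vandermonde sum remains.\<close>

lemma a_seq_eq_binomial_transform:
  "a_seq n = (\<Sum>k\<le>n. (n choose k) * franel k)"
proof -
  have "(\<Sum>k\<le>n. (n choose k) * franel k)
      = (\<Sum>k\<le>n. \<Sum>j\<le>n. (n choose k) * ((k choose j)\<^sup>2 * ((2 * j) choose k)))"
  proof (intro sum.cong refl)
    fix k assume "k \<in> {..n}"
    then have "franel k = (\<Sum>j\<le>n. (k choose j)\<^sup>2 * ((2 * j) choose k))"
      unfolding franel_eq_sum_sq
      by (intro sum.mono_neutral_left) (auto simp: binomial_eq_0)
    then show "(n choose k) * franel k
        = (\<Sum>j\<le>n. (n choose k) * ((k choose j)\<^sup>2 * ((2 * j) choose k)))"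
      by (simp add: sum_distrib_left)
  qed
  also have "\<dots> = (\<Sum>j\<le>n. \<Sum>k\<le>n. (n choose k) * ((k choose j)\<^sup>2 * ((2 * j) choose k)))"
    by (rule sum.swap)
  also have "\<dots> = (\<Sum>j\<le>n. (n choose j)\<^sup>2 * ((2 * j) choose j))"
  proof (intro sum.cong refl)
    fix j assume "j \<in> {..n}"
    then have j: "j \<le> n" by simp
    have "(\<Sum>k\<le>n. (n choose k) * ((k choose j)\<^sup>2 * ((2 * j) choose k)))
        = (\<Sum>l\<le>n - j. (n choose (j + l)) * (((j + l) choose j)\<^sup>2 * ((2 * j) choose (j + l))))"
      by (rule sum_atMost_from) (use j in \<open>auto simp: binomial_eq_0\<close>)
    \<comment> \<open>Each of the two other binomials receives one factor of the square.\<close>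
    also have "\<dots> = (\<Sum>l\<le>n - j. ((n choose (j + l)) * ((j + l) choose j))
        * (((2 * j) choose (j + l)) * ((j + l) choose j)))"
      by (simp add: power2_eq_square ac_simps)
    also have "\<dots> = (\<Sum>l\<le>n - j. (n choose j) * ((2 * j) choose j) * (((n - j) choose l) * (j choose l)))"
      unfolding choose_add_mult by (intro sum.cong refl) simp
    also have "\<dots> = (n choose j) * ((2 * j) choose j) * (\<Sum>l\<le>n - j. ((n - j) choose l) * (j choose l))"
      by (simp add: sum_distrib_left)
    also have "\<dots> = (n choose j) * ((2 * j) choose j) * (n choose j)"
      unfolding sum_choose_mult_choose using j by (simp flip: binomial_symmetric)
    finally show "(\<Sum>k\<le>n. (n choose k) * ((k choose j)\<^sup>2 * ((2 * j) choose k)))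
        = (n choose j)\<^sup>2 * ((2 * j) choose j)"
      by (simp add: power2_eq_square)
  qed
  finally show ?thesis by (simp add: a_seq_def atLeast0AtMost)
qed

text \<open>Vandermonde expands \<open>(a + b + k) choose k\<close> over a new index
  \<open>j\<close>; after the exchange, the sums over \<open>k\<close> and then over
  \<open>j\<close> are both Vandermonde sums. With \<open>a = i\<close> and \<open>b = n - i\<close>
  this rewrites the square of \<open>n choose i\<close> so that the sum over \<open>i\<close> in
  \<open>franel n\<close> can be carried out.\<close>

lemma sum_choose_choose_choose:
  "(\<Sum>k\<le>a. (a choose k) * (b choose k) * ((a + b + k) choose k)) = ((a + b) choose a)\<^sup>2"
proof -
  have "(\<Sum>k\<le>a. (a choose k) * (b choose k) * ((a + b + k) choose k))
      = (\<Sum>k\<le>a. \<Sum>j\<le>a. (a choose k) * (b choose k) * (((a + b) choose j) * (k choose j)))"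
  proof (intro sum.cong refl)
    fix k assume k: "k \<in> {..a}"
    have "((a + b + k) choose k) = (\<Sum>j\<le>k. ((a + b) choose j) * (k choose (k - j)))"
      by (rule vandermonde[symmetric])
    also have "\<dots> = (\<Sum>j\<le>k. ((a + b) choose j) * (k choose j))"
      by (intro sum.cong refl) (simp flip: binomial_symmetric)
    also have "\<dots> = (\<Sum>j\<le>a. ((a + b) choose j) * (k choose j))"
      using k by (intro sum.mono_neutral_left) (auto simp: binomial_eq_0)
    finally show "(a choose k) * (b choose k) * ((a + b + k) choose k)
        = (\<Sum>j\<le>a. (a choose k) * (b choose k) * (((a + b) choose j) * (k choose j)))"
      by (simp add: sum_distrib_left)
  qed
  also have "\<dots> = (\<Sum>j\<le>a. \<Sum>k\<le>a. (a choose k) * (b choose k) * (((a + b) choose j) * (k choose j)))"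
    by (rule sum.swap)
  also have "\<dots> = (\<Sum>j\<le>a. ((a + b) choose a) * ((a choose j) * (b choose j)))"
  proof (intro sum.cong refl)
    fix j assume "j \<in> {..a}"
    then have j: "j \<le> a" by simp
    have "(\<Sum>k\<le>a. (a choose k) * (b choose k) * (((a + b) choose j) * (k choose j)))
        = (\<Sum>l\<le>a - j. (a choose (j + l)) * (b choose (j + l)) * (((a + b) choose j) * ((j + l) choose j)))"
      by (rule sum_atMost_from) (use j in \<open>auto simp: binomial_eq_0\<close>)
    also have "\<dots> = (\<Sum>l\<le>a - j. ((a + b) choose j) * (a choose (j + l)) * ((b choose (j + l)) * ((j + l) choose j)))"
      by (simp add: ac_simps)
    \<comment> \<open>The factor from \<open>k choose j\<close> is absorbed into
      \<open>b choose k\<close>, and \<open>a choose k\<close> is reflected, so that the lower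
      indices add up to \<open>a - j\<close>.\<close>
    also have "\<dots> = (\<Sum>l\<le>a - j. ((a + b) choose j) * (b choose j) * (((b - j) choose l) * (a choose (a - j - l))))"
    proof (intro sum.cong refl)
      fix l assume "l \<in> {..a - j}"
      then have "(a choose (j + l)) = (a choose (a - j - l))"
        using j binomial_symmetric[of "j + l" a] by simp
      then show "((a + b) choose j) * (a choose (j + l)) * ((b choose (j + l)) * ((j + l) choose j))
        = ((a + b) choose j) * (b choose j) * (((b - j) choose l) * (a choose (a - j - l)))"
        by (simp add: choose_add_mult)
    qed
    also have "\<dots> = ((a + b) choose j) * (b choose j) * (((b - j) + a) choose (a - j))"
      by (simp only: vandermonde flip: sum_distrib_left)
    \<comment> \<open>For \<open>j > b\<close> the truncated \<open>(b - j) + a\<close> differs from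
      \<open>a + b - j\<close>, but then \<open>b choose j\<close> is 0.\<close>
    also have "\<dots> = ((a + b) choose a) * ((a choose j) * (b choose j))"
    proof (cases "j \<le> b")
      case True
      then have "(b - j) + a = a + b - j" by simp
      then show ?thesis using j choose_add_mult[of "a + b" j "a - j"] by simp
    qed (simp add: binomial_eq_0)
    finally show "(\<Sum>k\<le>a. (a choose k) * (b choose k) * (((a + b) choose j) * (k choose j)))
        = ((a + b) choose a) * ((a choose j) * (b choose j))" .
  qed
  also have "\<dots> = ((a + b) choose a)\<^sup>2"
    by (simp add: sum_choose_mult_choose power2_eq_square flip: sum_distrib_left)
  finally show ?thesis .
qed

text \<open>Two of the three factors \<open>n choose i\<close> are expanded by the preceding
  identity. After the exchange, the sum over \<open>i = k + l\<close> is a full binomial row of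
  order \<open>n - 2 * k\<close>, hence the power of 2. For \<open>2 * k > n\<close> the exponent is
  truncated to 0, but \<open>(n - k) choose k\<close> vanishes.\<close>

lemma franel_eq_sum_pow2:
  "franel n = (\<Sum>k\<le>n. ((n + k) choose k) * (n choose k) * ((n - k) choose k) * 2 ^ (n - 2 * k))"
proof -
  have "franel n = (\<Sum>i\<le>n. \<Sum>k\<le>n. (n choose i) * ((i choose k) * ((n - i) choose k) * ((n + k) choose k)))"
    unfolding franel_def atLeast0AtMost
  proof (intro sum.cong refl)
    fix i assume "i \<in> {..n}"
    then have i: "i \<le> n" by simp
    have "(n choose i)\<^sup>2 = (\<Sum>k\<le>i. (i choose k) * ((n - i) choose k) * ((n + k) choose k))"
      using sum_choose_choose_choose[of i "n - i"] i by simp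
    also have "\<dots> = (\<Sum>k\<le>n. (i choose k) * ((n - i) choose k) * ((n + k) choose k))"
      using i by (intro sum.mono_neutral_left) (auto simp: binomial_eq_0)
    finally have "(n choose i) * (n choose i)\<^sup>2
        = (n choose i) * (\<Sum>k\<le>n. (i choose k) * ((n - i) choose k) * ((n + k) choose k))"
      by simp
    then show "(n choose i) ^ 3 = (\<Sum>k\<le>n. (n choose i) * ((i choose k) * ((n - i) choose k) * ((n + k) choose k)))"
      by (simp add: sum_distrib_left power2_eq_square power3_eq_cube)
  qed
  also have "\<dots> = (\<Sum>k\<le>n. \<Sum>i\<le>n. (n choose i) * ((i choose k) * ((n - i) choose k) * ((n + k) choose k)))"
    by (rule sum.swap)
  also have "\<dots> = (\<Sum>k\<le>n. ((n + k) choose k) * (n choose k) * ((n - k) choose k) * 2 ^ (n - 2 * k))"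
  proof (intro sum.cong refl)
    fix k assume "k \<in> {..n}"
    then have k: "k \<le> n" by simp
    have "(\<Sum>i\<le>n. (n choose i) * ((i choose k) * ((n - i) choose k) * ((n + k) choose k)))
        = (\<Sum>l\<le>n - k. (n choose (k + l)) * (((k + l) choose k) * ((n - (k + l)) choose k) * ((n + k) choose k)))"
      by (rule sum_atMost_from) (use k in \<open>auto simp: binomial_eq_0\<close>)
    also have "\<dots> = (\<Sum>l\<le>n - k. ((n + k) choose k) * (n choose k) * ((n - k) choose k) * ((n - 2 * k) choose l))"
    proof (intro sum.cong refl)
      fix l
      \<comment> \<open>Disjoint sets of sizes \<open>l\<close> and \<open>k\<close> are chosen from
        \<open>n - k\<close> elements; the order of the two choices is reversed.\<close>
      have "((n - k) choose l) * ((n - k - l) choose k) = ((n - k) choose (k + l)) * ((k + l) choose l)"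
        using choose_add_mult[of "n - k" l k] by (simp add: add.commute)
      also have "\<dots> = ((n - k) choose (k + l)) * ((k + l) choose k)"
        using binomial_symmetric[of l "k + l"] by simp
      also have "\<dots> = ((n - k) choose k) * ((n - k - k) choose l)"
        by (rule choose_add_mult)
      finally have *: "((n - k) choose l) * ((n - k - l) choose k) = ((n - k) choose k) * ((n - 2 * k) choose l)"
        by (simp add: mult_2)
      have "(n choose (k + l)) * (((k + l) choose k) * ((n - (k + l)) choose k) * ((n + k) choose k))
          = ((n choose (k + l)) * ((k + l) choose k)) * ((n - k - l) choose k) * ((n + k) choose k)"
        by simp
      also have "\<dots> = (n choose k) * (((n - k) choose l) * ((n - k - l) choose k)) * ((n + k) choose k)"
        by (simp add: choose_add_mult)
      finally show "(n choose (k + l)) * (((k + l) choose k) * ((n - (k + l)) choose k) * ((n + k) choose k))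
          = ((n + k) choose k) * (n choose k) * ((n - k) choose k) * ((n - 2 * k) choose l)"
        unfolding * by simp
    qed
    also have "\<dots> = ((n + k) choose k) * (n choose k) * ((n - k) choose k) * (\<Sum>l\<le>n - k. (n - 2 * k) choose l)"
      by (simp add: sum_distrib_left)
    also have "(\<Sum>l\<le>n - k. (n - 2 * k) choose l) = (\<Sum>l\<le>n - 2 * k. (n - 2 * k) choose l)"
      by (intro sum.mono_neutral_right) (auto simp: binomial_eq_0)
    also have "\<dots> = 2 ^ (n - 2 * k)" by (rule choose_row_sum)
    finally show "(\<Sum>i\<le>n. (n choose i) * ((i choose k) * ((n - i) choose k) * ((n + k) choose k)))
        = ((n + k) choose k) * (n choose k) * ((n - k) choose k) * 2 ^ (n - 2 * k)" .
  qed
  finally show ?thesis .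
qed

section \<open>Two expansions of the Franel numbers\<close>

text \<open>This is the multinomial coefficient \<open>(3k)! / (k!)^3\<close>. As an input
  abbreviation it is the same term as the product in the theorem, so nothing has to be
  unfolded.\<close>

abbreviation (input) cubic_coeff :: "nat \<Rightarrow> nat" where
  "cubic_coeff k \<equiv> ((2 * k) choose k) * ((3 * k) choose k)"

lemma cubic_coeff_fact: "cubic_coeff k * fact k ^ 3 = fact (3 * k)"
proof -
  have 1: "fact k * fact (2 * k) * ((3 * k) choose k) = (fact (3 * k) :: nat)"
    using binomial_fact_lemma[of k "3 * k"] by (simp add: mult_2)
  have 2: "fact k * fact k * ((2 * k) choose k) = (fact (2 * k) :: nat)"
    using binomial_fact_lemma[of k "2 * k"] by (simp add: mult_2)
  show ?thesis
    unfolding 1[symmetric] 2[symmetric] power3_eq_cube by (simp only: ac_simps)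
qed

text \<open>The factor \<open>(3k)!\<close> cancels. This factorial form serves both expansions;
  \<open>r\<close> stands for \<open>N - 3 * k\<close> and avoids truncated subtraction.\<close>

lemma cubic_coeff_choose:
  assumes "N = 3 * k + r"
  shows "(of_nat (cubic_coeff k * (N choose (3 * k))) :: rat) = fact N / (fact k ^ 3 * fact r)"
proof -
  have "fact (3 * k) * fact r * (N choose (3 * k)) = (fact N :: nat)"
    using binomial_fact_lemma[of "3 * k" N] assms by simp
  then have "cubic_coeff k * (N choose (3 * k)) * (fact k ^ 3 * fact r) = fact N"
    unfolding cubic_coeff_fact[of k, symmetric] by (simp only: ac_simps)
  then have "of_nat (cubic_coeff k * (N choose (3 * k)) * (fact k ^ 3 * fact r)) = (of_nat (fact N) :: rat)"
    by (rule arg_cong)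
  then have "of_nat (cubic_coeff k * (N choose (3 * k))) * (fact k ^ 3 * fact r) = (fact N :: rat)"
    by (simp only: of_nat_mult of_nat_fact of_nat_power)
  then show ?thesis by (simp only: eq_divide_eq) simp
qed

text \<open>Both products of binomials equal \<open>(n + k)! / (k!^3 (n - 2k)!)\<close>. The power
  of 2 is written as a quotient to fit the shape \<open>c ^ n / c ^ (d * k)\<close> shared with the
  expansion in powers of -4.\<close>

lemma franel_expansion_2:
  "of_nat (franel n) = (\<Sum>k\<le>n. of_nat (cubic_coeff k * ((n + k) choose (3 * k))) * (2 ^ n / 2 ^ (2 * k)) :: rat)"
proof -
  have *: "((n + k) choose k) * (n choose k) * ((n - k) choose k)
      = cubic_coeff k * ((n + k) choose (3 * k))" if "2 * k \<le> n" for k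
  proof -
    obtain r where r: "n = 2 * k + r" using \<open>2 * k \<le> n\<close> le_Suc_ex by blast
    have "(of_nat (((n + k) choose k) * (n choose k) * ((n - k) choose k)) :: rat)
        = fact (n + k) / (fact k ^ 3 * fact r)"
      using r by (simp add: binomial_fact power3_eq_cube mult_2)
    also have "\<dots> = of_nat (cubic_coeff k * ((n + k) choose (3 * k)))"
      by (rule cubic_coeff_choose[symmetric]) (use r in simp)
    finally show ?thesis by (simp only: of_nat_eq_iff)
  qed
  have "(of_nat (((n + k) choose k) * (n choose k) * ((n - k) choose k) * 2 ^ (n - 2 * k)) :: rat)
      = of_nat (cubic_coeff k * ((n + k) choose (3 * k))) * (2 ^ n / 2 ^ (2 * k))" for k
  proof (cases "2 * k \<le> n")
    case True
    then have "of_nat (2 ^ (n - 2 * k)) = (2 ^ n / 2 ^ (2 * k) :: rat)"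
      by (simp only: of_nat_power of_nat_numeral) (simp add: power_diff)
    with * True show ?thesis by (simp only: of_nat_mult)
  qed (simp add: binomial_eq_0)
  then show ?thesis unfolding franel_eq_sum_pow2 of_nat_sum by (intro sum.cong) auto
qed

text \<open>\<open>H\<close> is kept apart from the shift of \<open>G\<close> because at the last
  index only \<open>H K = 0\<close> is required, while \<open>G (Suc K)\<close> may be
  meaningless.\<close>

lemma sum_telescope_zero:
  fixes G H :: "nat \<Rightarrow> 'a::ab_group_add"
  assumes "\<And>k. k < K \<Longrightarrow> H k = G (Suc k)" "H K = 0" "G 0 = 0"
  shows "(\<Sum>k\<le>K. H k - G k) = 0"
proof -
  have "(\<Sum>k\<le>K. H k) = (\<Sum>k<K. G (Suc k))"
    using assms(1,2) by (simp flip: lessThan_Suc_atMost)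
  moreover have "(\<Sum>k\<le>K. G k) = (\<Sum>k<K. G (Suc k))"
    using assms(3) by (simp add: sum.lessThan_Suc_shift del: sum.lessThan_Suc flip: lessThan_Suc_atMost)
  ultimately show ?thesis by (simp add: sum_subtractf)
qed

text \<open>
  Creative telescoping in the style of Zeilberger: the three summands of index \<open>k\<close> are polynomial multiples
  of \<open>X k\<close>, chosen so that these identities also hold at the boundary where summands vanish,
  and \<open>4 t k^3 X k\<close> with \<open>t\<close> independent of \<open>k\<close> is the certificate.
\<close>

lemma cubic_expansion_2_recurrence:
  fixes S :: "nat \<Rightarrow> rat"
  assumes S: "\<And>n. S n = (\<Sum>k\<le>n. of_nat (cubic_coeff k * ((n + k) choose (3 * k))) * (2 ^ n / 2 ^ (2 * k)))"
  shows "(of_nat n + 2)\<^sup>2 * S (n + 2)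
    = (7 * (of_nat n + 1)\<^sup>2 + 7 * (of_nat n + 1) + 2) * S (n + 1) + 8 * (of_nat n + 1)\<^sup>2 * S n"
proof -
  \<comment> \<open>The last index at which a summand of \<open>S (n + 2)\<close> can be
    nonzero.\<close>
  define K where "K = (n + 2) div 2"
  define T where "T m k = (of_nat (cubic_coeff k * ((m + k) choose (3 * k))) * (2 ^ m / 2 ^ (2 * k)) :: rat)" for m k
  \<comment> \<open>The denominator is that of \<open>T (n + 2) k\<close>, the largest of the three;
    the other two summands then carry the factors \<open>r\<close> and \<open>r (r - 1)\<close> with
    \<open>r = n + 2 - 2k\<close>, which vanish exactly where the binomials do.\<close>
  define X where "X k = (fact (n + k) / (fact k ^ 3 * fact (n + 2 - 2 * k)) * (2 ^ n / 2 ^ (2 * k)) :: rat)" for k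
  \<comment> \<open>The value is forced by \<open>step\<close>: after division by \<open>X k\<close>
    the cubes of \<open>k\<close> in \<open>H\<close> and \<open>G\<close> cancel, and the
    coefficients of \<open>k^2\<close> are \<open>12 (3n + 4)\<close> on the left and
    \<open>-2 t\<close> on the right.\<close>
  define t where "t = (- 6 * (3 * of_nat n + 4) :: rat)"
  define G where "G k = 4 * t * of_nat k ^ 3 * X k" for k
  \<comment> \<open>This is \<open>G (k + 1)\<close> expressed through \<open>X k\<close> by means
    of the ratio \<open>X (k + 1) / X k\<close>.\<close>
  define H where "H k = t * (of_nat n + 1 + of_nat k) * (of_nat n + 2 - 2 * of_nat k)
    * (of_nat n + 1 - 2 * of_nat k) * X k" for k
  have T_sum: "S m = (\<Sum>k\<le>K. T m k)" if "m \<le> n + 2" for m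
  proof -
    have z: "T m k = 0" if "m < 2 * k" for k
      using that by (simp add: T_def binomial_eq_0)
    have "(\<Sum>k\<le>m. T m k) = (\<Sum>k\<le>m div 2. T m k)"
      by (intro sum.mono_neutral_right) (auto intro!: z)
    moreover have "(\<Sum>k\<le>K. T m k) = (\<Sum>k\<le>m div 2. T m k)"
      using that unfolding K_def by (intro sum.mono_neutral_right) (auto intro!: z div_le_mono)
    ultimately show ?thesis by (simp add: S T_def)
  qed
  have step: "(of_nat n + 2)\<^sup>2 * T (n + 2) k - (7 * (of_nat n + 1)\<^sup>2 + 7 * (of_nat n + 1) + 2) * T (n + 1) k
      - 8 * (of_nat n + 1)\<^sup>2 * T n k = H k - G k" if "k \<le> K" for k
  proof -
    have "2 * k \<le> n + 2" using that unfolding K_def by linarith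
    then obtain r where r: "n + 2 = 2 * k + r" using le_Suc_ex by blast
    have n_eq: "(of_nat n :: rat) = 2 * of_nat k + of_nat r - 2"
      using arg_cong[OF r, of "of_nat :: nat \<Rightarrow> rat"] by simp
    have X: "X k = fact (n + k) / (fact k ^ 3 * fact r) * (2 ^ n / 2 ^ (2 * k))"
      using r by (simp add: X_def)
    have F: "fact (n + 2 + k) = ((of_nat n + 1 + of_nat k) * (of_nat n + 2 + of_nat k) * fact (n + k) :: rat)"
      by (simp add: algebra_simps)
    have "T (n + 2) k = fact (n + 2 + k) / (fact k ^ 3 * fact r) * (4 * (2 ^ n / 2 ^ (2 * k)))"
      unfolding T_def by (subst cubic_coeff_choose[of _ _ r]) (use r in simp, simp add: power_add)
    then have T2: "T (n + 2) k = 4 * (of_nat n + 1 + of_nat k) * (of_nat n + 2 + of_nat k) * X k"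
      unfolding X by (simp add: F ac_simps)
    have T1: "T (n + 1) k = 2 * (of_nat n + 1 + of_nat k) * of_nat r * X k"
    proof (cases r)
      case 0
      then show ?thesis using r by (simp add: T_def binomial_eq_0)
    next
      case (Suc q)
      have "T (n + 1) k = fact (n + 1 + k) / (fact k ^ 3 * fact q) * (2 * (2 ^ n / 2 ^ (2 * k)))"
        unfolding T_def by (subst cubic_coeff_choose[of _ _ q]) (use r Suc in simp, simp)
      moreover have "fact (n + 1 + k) = ((of_nat n + 1 + of_nat k) * fact (n + k) :: rat)"
        by (simp add: algebra_simps)
      moreover have "fact r = (of_nat r * fact q :: rat)" "of_nat r \<noteq> (0 :: rat)"
        using Suc by simp_all
      ultimately show ?thesis by (simp add: X ac_simps del: distrib_left_numeral distrib_right_numeral)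
    qed
    have T0: "T n k = of_nat r * (of_nat r - 1) * X k"
    proof (cases "r < 2")
      case True
      then have "r = 0 \<or> r = 1" by linarith
      then show ?thesis using r by (auto simp: T_def binomial_eq_0)
    next
      case False
      then obtain q where q: "r = q + 2" by (metis add.commute le_Suc_ex not_less)
      have "T n k = fact (n + k) / (fact k ^ 3 * fact q) * (2 ^ n / 2 ^ (2 * k))"
        unfolding T_def by (subst cubic_coeff_choose[of _ _ q]) (use r q in simp, simp)
      moreover have "fact r = (of_nat r * (of_nat r - 1) * fact q :: rat)"
        "of_nat r \<noteq> (0 :: rat)" "of_nat r - 1 \<noteq> (0 :: rat)"
        using q of_nat_neq_0[of q, where 'a = rat] by (simp_all add: algebra_simps)
      ultimately show ?thesis by (simp add: X ac_simps del: distrib_left_numeral distrib_right_numeral)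
    qed
    show ?thesis
      unfolding T2 T1 T0 H_def G_def t_def n_eq power2_eq_square power3_eq_cube by (simp add: algebra_simps)
  qed
  have "(\<Sum>k\<le>K. H k - G k) = 0"
  proof (rule sum_telescope_zero)
    show "G 0 = 0" by (simp add: G_def)
    \<comment> \<open>Depending on the parity of \<open>n\<close>, one or the other linear factor of
      \<open>H K\<close> is 0.\<close>
    have "n + 2 = 2 * K \<or> n + 1 = 2 * K" unfolding K_def by linarith
    then have "of_nat n + 2 - 2 * of_nat K = (0 :: rat) \<or> of_nat n + 1 - 2 * of_nat K = (0 :: rat)"
      using arg_cong[of "n + 2" "2 * K" "of_nat :: nat \<Rightarrow> rat"] arg_cong[of "n + 1" "2 * K" "of_nat :: nat \<Rightarrow> rat"]
      by auto
    then show "H K = 0" unfolding H_def by auto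
    fix k assume "k < K"
    then have "2 * k + 2 \<le> n + 2" unfolding K_def by linarith
    then obtain q where q: "n = 2 * k + q" using le_Suc_ex[of "2 * k" n] by auto
    have "G (Suc k) = 4 * t * (of_nat k + 1) ^ 3 * (fact (n + Suc k) / (fact (Suc k) ^ 3 * fact q) * (2 ^ n / 2 ^ (2 * k + 2)))"
      using q by (simp add: G_def X_def add_ac)
    also have "\<dots> = t * (of_nat n + 1 + of_nat k) * (fact (n + k) / (fact k ^ 3 * fact q)) * (2 ^ n / 2 ^ (2 * k))"
      by (simp add: power_mult_distrib add_ac)
    also have "\<dots> = H k"
    proof -
      have e: "n + 2 - 2 * k = Suc (Suc q)" "of_nat n + 2 - 2 * of_nat k = (of_nat (Suc (Suc q)) :: rat)"
        "of_nat n + 1 - 2 * of_nat k = (of_nat (Suc q) :: rat)"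
        using q by simp_all
      show ?thesis unfolding H_def X_def e by (simp del: of_nat_Suc)
    qed
    finally show "H k = G (Suc k)" by simp
  qed
  then have "(\<Sum>k\<le>K. (of_nat n + 2)\<^sup>2 * T (n + 2) k - (7 * (of_nat n + 1)\<^sup>2 + 7 * (of_nat n + 1) + 2) * T (n + 1) k
      - 8 * (of_nat n + 1)\<^sup>2 * T n k) = 0"
    using step by simp
  then show ?thesis
    by (simp add: T_sum sum_subtractf flip: sum_distrib_left)
qed

text \<open>The certificate has the same shape \<open>4 t k^3 X k\<close> as for powers of 2, with
  another \<open>X\<close> and \<open>t\<close>. The common recurrence is Franel's, with its index
  shifted by one.\<close>

lemma cubic_expansion_4_recurrence:
  fixes S :: "nat \<Rightarrow> rat"
  assumes S: "\<And>n. S n = (\<Sum>k\<le>n. of_nat (cubic_coeff k * ((n + 2 * k) choose (3 * k))) * ((- 4) ^ n / (- 4) ^ k))"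
  shows "(of_nat n + 2)\<^sup>2 * S (n + 2)
    = (7 * (of_nat n + 1)\<^sup>2 + 7 * (of_nat n + 1) + 2) * S (n + 1) + 8 * (of_nat n + 1)\<^sup>2 * S n"
proof -
  \<comment> \<open>Here \<open>(m + 2 * k) choose (3 * k)\<close> vanishes only for
    \<open>k > m\<close>, so the range is twice as long as for powers of 2.\<close>
  define K where "K = n + 2"
  define T where "T m k = (of_nat (cubic_coeff k * ((m + 2 * k) choose (3 * k))) * ((- 4) ^ m / (- 4) ^ k) :: rat)" for m k
  define X where "X k = (fact (n + 2 * k) / (fact k ^ 3 * fact (n + 2 - k)) * ((- 4) ^ n / (- 4) ^ k) :: rat)" for k
  \<comment> \<open>Again the cubes of \<open>k\<close> cancel, and comparing coefficients of
    \<open>k^2\<close> gives \<open>24 (3n + 5) = -2 t\<close>.\<close>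
  define t where "t = (- 12 * (3 * of_nat n + 5) :: rat)"
  define G where "G k = 4 * t * of_nat k ^ 3 * X k" for k
  define H where "H k = - t * (of_nat n + 1 + 2 * of_nat k) * (of_nat n + 2 + 2 * of_nat k)
    * (of_nat n + 2 - of_nat k) * X k" for k
  have T_sum: "S m = (\<Sum>k\<le>K. T m k)" if "m \<le> n + 2" for m
    unfolding S K_def T_def using that by (intro sum.mono_neutral_left) (auto simp: binomial_eq_0)
  have step: "(of_nat n + 2)\<^sup>2 * T (n + 2) k - (7 * (of_nat n + 1)\<^sup>2 + 7 * (of_nat n + 1) + 2) * T (n + 1) k
      - 8 * (of_nat n + 1)\<^sup>2 * T n k = H k - G k" if "k \<le> K" for k
  proof -
    obtain r where r: "n + 2 = k + r"
      using \<open>k \<le> K\<close> le_Suc_ex[of k "n + 2"] unfolding K_def by auto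
    have n_eq: "(of_nat n :: rat) = of_nat k + of_nat r - 2"
      using arg_cong[OF r, of "of_nat :: nat \<Rightarrow> rat"] by simp
    have X: "X k = fact (n + 2 * k) / (fact k ^ 3 * fact r) * ((- 4) ^ n / (- 4) ^ k)"
      using r by (simp add: X_def)
    have F: "fact (n + 2 + 2 * k) = ((of_nat n + 1 + 2 * of_nat k) * (of_nat n + 2 + 2 * of_nat k) * fact (n + 2 * k) :: rat)"
      by (simp add: algebra_simps)
    have "T (n + 2) k = fact (n + 2 + 2 * k) / (fact k ^ 3 * fact r) * (16 * ((- 4) ^ n / (- 4) ^ k))"
      unfolding T_def by (subst cubic_coeff_choose[of _ _ r]) (use r in simp, simp add: power_add)
    then have T2: "T (n + 2) k = 16 * (of_nat n + 1 + 2 * of_nat k) * (of_nat n + 2 + 2 * of_nat k) * X k"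
      unfolding X by (simp add: F ac_simps)
    have T1: "T (n + 1) k = - 4 * (of_nat n + 1 + 2 * of_nat k) * of_nat r * X k"
    proof (cases r)
      case 0
      then show ?thesis using r by (simp add: T_def binomial_eq_0)
    next
      case (Suc q)
      have "T (n + 1) k = fact (n + 1 + 2 * k) / (fact k ^ 3 * fact q) * (- 4 * ((- 4) ^ n / (- 4) ^ k))"
        unfolding T_def by (subst cubic_coeff_choose[of _ _ q]) (use r Suc in simp, simp)
      moreover have "fact (n + 1 + 2 * k) = ((of_nat n + 1 + 2 * of_nat k) * fact (n + 2 * k) :: rat)"
        by (simp add: algebra_simps)
      moreover have "fact r = (of_nat r * fact q :: rat)" "of_nat r \<noteq> (0 :: rat)"
        using Suc by simp_all
      ultimately show ?thesis by (simp add: X ac_simps del: distrib_left_numeral distrib_right_numeral)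
    qed
    have T0: "T n k = of_nat r * (of_nat r - 1) * X k"
    proof (cases "r < 2")
      case True
      then have "r = 0 \<or> r = 1" by linarith
      then show ?thesis using r by (auto simp: T_def binomial_eq_0)
    next
      case False
      then obtain q where q: "r = q + 2" by (metis add.commute le_Suc_ex not_less)
      have "T n k = fact (n + 2 * k) / (fact k ^ 3 * fact q) * ((- 4) ^ n / (- 4) ^ k)"
        unfolding T_def by (subst cubic_coeff_choose[of _ _ q]) (use r q in simp, simp)
      moreover have "fact r = (of_nat r * (of_nat r - 1) * fact q :: rat)"
        "of_nat r \<noteq> (0 :: rat)" "of_nat r - 1 \<noteq> (0 :: rat)"
        using q of_nat_neq_0[of q, where 'a = rat] by (simp_all add: algebra_simps)
      ultimately show ?thesis by (simp add: X ac_simps del: distrib_left_numeral distrib_right_numeral)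
    qed
    show ?thesis
      unfolding T2 T1 T0 H_def G_def t_def n_eq power2_eq_square power3_eq_cube by (simp add: algebra_simps)
  qed
  have "(\<Sum>k\<le>K. H k - G k) = 0"
  proof (rule sum_telescope_zero)
    show "G 0 = 0" by (simp add: G_def)
    show "H K = 0" by (simp add: H_def K_def)
    fix k assume "k < K"
    then obtain q where q: "n + 1 = k + q" unfolding K_def using le_Suc_ex[of k "n + 1"] by auto
    have n_eq: "(of_nat n :: rat) = of_nat k + of_nat q - 1"
      using arg_cong[OF q, of "of_nat :: nat \<Rightarrow> rat"] by simp
    have "G (Suc k) = 4 * t * (of_nat k + 1) ^ 3 * (fact (n + 2 * k + 2) / (fact (Suc k) ^ 3 * fact q) * ((- 4) ^ n / (- 4) ^ (k + 1)))"
      using q by (simp add: G_def X_def add_ac)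
    also have "\<dots> = - t * (of_nat n + 1 + 2 * of_nat k) * (of_nat n + 2 + 2 * of_nat k)
        * (fact (n + 2 * k) / (fact k ^ 3 * fact q)) * ((- 4) ^ n / (- 4) ^ k)"
      by (simp add: power_mult_distrib add_ac) (simp add: divide_simps)
    also have "\<dots> = H k"
    proof -
      have "n + 2 - k = Suc q" "of_nat n + 2 - of_nat k = (of_nat (Suc q) :: rat)"
        using q n_eq by auto
      then show ?thesis by (simp add: H_def X_def) (simp add: divide_simps)
    qed
    finally show "H k = G (Suc k)" by simp
  qed
  then have "(\<Sum>k\<le>K. (of_nat n + 2)\<^sup>2 * T (n + 2) k - (7 * (of_nat n + 1)\<^sup>2 + 7 * (of_nat n + 1) + 2) * T (n + 1) k
      - 8 * (of_nat n + 1)\<^sup>2 * T n k) = 0"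
    using step by simp
  then show ?thesis
    by (simp add: T_sum sum_subtractf flip: sum_distrib_left)
qed

text \<open>The recurrence has order two, so two consecutive values are carried through the
  induction; its leading coefficient is nonzero over the rationals.\<close>

lemma franel_expansion_4:
  "of_nat (franel n) = (\<Sum>k\<le>n. of_nat (cubic_coeff k * ((n + 2 * k) choose (3 * k))) * ((- 4) ^ n / (- 4) ^ k) :: rat)"
proof -
  define S :: "nat \<Rightarrow> rat" where
    "S n = (\<Sum>k\<le>n. of_nat (cubic_coeff k * ((n + 2 * k) choose (3 * k))) * ((- 4) ^ n / (- 4) ^ k))" for n
  have "of_nat (franel n) = S n \<and> of_nat (franel (Suc n)) = S (Suc n)"
  proof (induction n)
    case 0
    show ?case by (simp add: S_def franel_def numeral_2_eq_2 numeral_3_eq_3)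
  next
    case (Suc n)
    have "(of_nat n + 2)\<^sup>2 * of_nat (franel (n + 2)) = (of_nat n + 2)\<^sup>2 * S (n + 2)"
      using cubic_expansion_2_recurrence[OF franel_expansion_2, of n] cubic_expansion_4_recurrence[OF S_def, of n] Suc by simp
    moreover have "(of_nat n + 2 :: rat) \<noteq> 0"
      by (metis of_nat_add of_nat_numeral of_nat_0_eq_iff add_is_0 zero_neq_numeral)
    ultimately show ?case using Suc by simp
  qed
  then show ?thesis by (simp add: S_def)
qed

section \<open>Congruences between rationals\<close>

text \<open>Allows fractions that are not in lowest terms: the reduced denominator divides every
  other denominator, so it inherits being prime to \<open>p\<close>.\<close>

lemma Zp_iff:
  assumes "prime p"
  shows "x \<in> Zp p \<longleftrightarrow> (\<exists>a b. \<not> int p dvd b \<and> x = of_int a / of_int b)"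
proof
  assume x: "x \<in> Zp p"
  obtain a b where ab: "quotient_of x = (a, b)" by (cases "quotient_of x")
  have "coprime b (int p)" using x ab by (simp add: Zp_def)
  then have "\<not> int p dvd b"
    using assms by (metis coprime_absorb_right coprime_commute not_prime_unit prime_nat_int_transfer)
  then show "\<exists>a b. \<not> int p dvd b \<and> x = of_int a / of_int b"
    using quotient_of_div[OF ab] by blast
next
  assume "\<exists>a b. \<not> int p dvd b \<and> x = of_int a / of_int b"
  then obtain a b where ab: "\<not> int p dvd b" "x = of_int a / of_int b" by blast
  obtain c d where cd: "quotient_of x = (c, d)" by (cases "quotient_of x")
  have "b \<noteq> 0" using ab(1) by auto
  moreover have "d > 0" using quotient_of_denom_pos[OF cd] .
  moreover have "of_int a / of_int b = (of_int c / of_int d :: rat)"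
    using quotient_of_div[OF cd] ab(2) by simp
  ultimately have "of_int (a * d) = (of_int (c * b) :: rat)" by (simp add: field_simps)
  then have "a * d = c * b" by (simp only: of_int_eq_iff)
  then have "d dvd c * b" by (metis dvd_triv_right)
  then have "d dvd b"
    using quotient_of_coprime[OF cd] coprime_dvd_mult_right_iff coprime_commute by blast
  then have "\<not> int p dvd d" using ab(1) dvd_trans by blast
  then have "coprime (int p) d" using assms by (intro prime_imp_coprime) auto
  then show "x \<in> Zp p" using cd by (simp add: Zp_def coprime_commute)
qed

text \<open>The units of the local ring. The condition \<open>x \<noteq> 0\<close> matters because
  \<open>inverse 0 = 0\<close> lies in \<open>Zp p\<close>.\<close>

definition zp_unit :: "nat \<Rightarrow> rat \<Rightarrow> bool" where
  "zp_unit p x \<longleftrightarrow> x \<in> Zp p \<and> x \<noteq> 0 \<and> inverse x \<in> Zp p"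

context
  fixes p :: nat
  assumes p: "prime p"
begin

lemma Zp_of_int [simp]: "of_int a \<in> Zp p"
proof -
  have "\<not> int p dvd 1" using p prime_gt_1_nat[OF p] by simp
  then show ?thesis unfolding Zp_iff[OF p] by (intro exI[of _ a] exI[of _ 1]) simp
qed

lemma Zp_of_nat [simp]: "of_nat a \<in> Zp p"
  using Zp_of_int[of "int a"] by simp

lemma Zp_numeral [simp]: "numeral a \<in> Zp p" "0 \<in> Zp p" "1 \<in> Zp p"
  using Zp_of_int[of "numeral a"] Zp_of_int[of 0] Zp_of_int[of 1] by simp_all

lemma Zp_mult [intro]:
  assumes "x \<in> Zp p" "y \<in> Zp p"
  shows "x * y \<in> Zp p"
proof -
  obtain a b where "\<not> int p dvd b" "x = of_int a / of_int b"
    using assms(1) unfolding Zp_iff[OF p] by blast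
  moreover obtain c d where "\<not> int p dvd d" "y = of_int c / of_int d"
    using assms(2) unfolding Zp_iff[OF p] by blast
  ultimately show ?thesis unfolding Zp_iff[OF p] using p
    by (intro exI[of _ "a * c"] exI[of _ "b * d"]) (simp add: prime_dvd_mult_iff)
qed

lemma Zp_add [intro]:
  assumes "x \<in> Zp p" "y \<in> Zp p"
  shows "x + y \<in> Zp p"
proof -
  obtain a b where ab: "\<not> int p dvd b" "x = of_int a / of_int b"
    using assms(1) unfolding Zp_iff[OF p] by blast
  moreover obtain c d where cd: "\<not> int p dvd d" "y = of_int c / of_int d"
    using assms(2) unfolding Zp_iff[OF p] by blast
  moreover have "b \<noteq> 0" "d \<noteq> 0" using ab(1) cd(1) by auto
  ultimately show ?thesis unfolding Zp_iff[OF p] using p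
    by (intro exI[of _ "a * d + c * b"] exI[of _ "b * d"]) (simp add: prime_dvd_mult_iff add_frac_eq)
qed

lemma Zp_minus [intro]: "- x \<in> Zp p" if "x \<in> Zp p"
  using Zp_mult[OF Zp_of_int[of "- 1"] that] by simp

lemma Zp_diff [intro]: "x - y \<in> Zp p" if "x \<in> Zp p" "y \<in> Zp p"
  using Zp_add[OF that(1) Zp_minus[OF that(2)]] by simp

lemma Zp_power [intro]: "x ^ n \<in> Zp p" if "x \<in> Zp p"
  by (induction n) (use that in auto)

lemma Zp_sum [intro]: "(\<Sum>i\<in>A. f i) \<in> Zp p" if "\<And>i. i \<in> A \<Longrightarrow> f i \<in> Zp p"
  using that by (induction A rule: infinite_finite_induct) auto

lemma zp_congI: "zp_cong p x y" if "x \<in> Zp p" "y \<in> Zp p" "z \<in> Zp p" "x - y = of_nat p * z"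
  using that by (auto simp: zp_cong_def)

lemma zp_congE:
  assumes "zp_cong p x y"
  obtains z where "x \<in> Zp p" "y \<in> Zp p" "z \<in> Zp p" "x = y + of_nat p * z"
  using assms by (auto simp: zp_cong_def algebra_simps)

lemma zp_cong_refl: "zp_cong p x x" if "x \<in> Zp p"
  by (rule zp_congI[of _ _ 0]) (use that in auto)

lemma zp_cong_trans [trans]:
  assumes "zp_cong p x y" "zp_cong p y w"
  shows "zp_cong p x w"
proof -
  obtain z where "x \<in> Zp p" "z \<in> Zp p" "x = y + of_nat p * z" using assms(1) by (rule zp_congE)
  moreover obtain z' where "w \<in> Zp p" "z' \<in> Zp p" "y = w + of_nat p * z'" using assms(2) by (rule zp_congE)
  ultimately show ?thesis by (intro zp_congI[of _ _ "z + z'"] Zp_add) (assumption | simp add: algebra_simps)+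
qed

lemma zp_cong_sym:
  assumes "zp_cong p x y"
  shows "zp_cong p y x"
proof -
  obtain z where "x \<in> Zp p" "y \<in> Zp p" "z \<in> Zp p" "x = y + of_nat p * z" using assms by (rule zp_congE)
  then show ?thesis by (intro zp_congI[of _ _ "- z"] Zp_minus) (assumption | simp)+
qed

lemma zp_cong_add:
  assumes "zp_cong p x y" "zp_cong p x' y'"
  shows "zp_cong p (x + x') (y + y')"
proof -
  obtain z where "x \<in> Zp p" "y \<in> Zp p" "z \<in> Zp p" "x = y + of_nat p * z" using assms(1) by (rule zp_congE)
  moreover obtain z' where "x' \<in> Zp p" "y' \<in> Zp p" "z' \<in> Zp p" "x' = y' + of_nat p * z'" using assms(2) by (rule zp_congE)
  ultimately show ?thesis by (intro zp_congI[of _ _ "z + z'"] Zp_add) (assumption | simp add: algebra_simps)+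
qed

lemma zp_cong_mult:
  assumes "zp_cong p x y" "zp_cong p x' y'"
  shows "zp_cong p (x * x') (y * y')"
proof -
  obtain z where "x \<in> Zp p" "y \<in> Zp p" "z \<in> Zp p" "x = y + of_nat p * z" using assms(1) by (rule zp_congE)
  moreover obtain z' where "x' \<in> Zp p" "y' \<in> Zp p" "z' \<in> Zp p" "x' = y' + of_nat p * z'" using assms(2) by (rule zp_congE)
  ultimately show ?thesis
    by (intro zp_congI[of _ _ "y * z' + z * y' + of_nat p * z * z'"] Zp_add Zp_mult Zp_of_nat)
      (assumption | simp add: algebra_simps)+
qed

lemma zp_cong_mult_left: "zp_cong p (c * x) (c * y)" if "c \<in> Zp p" "zp_cong p x y"
  using zp_cong_mult[OF zp_cong_refl] that .

lemma zp_cong_sum: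
  "zp_cong p (\<Sum>i\<in>A. f i) (\<Sum>i\<in>A. g i)" if "\<And>i. i \<in> A \<Longrightarrow> zp_cong p (f i) (g i)"
  using that by (induction A rule: infinite_finite_induct) (auto intro: zp_cong_add zp_cong_refl)

lemma zp_cong_of_int:
  assumes "[a = b] (mod int p)"
  shows "zp_cong p (of_int a) (of_int b)"
proof -
  obtain c where "a - b = int p * c" using assms by (auto simp: cong_iff_dvd_diff)
  then have "of_int (a - b) = (of_int (int p * c) :: rat)" by (rule arg_cong)
  then show ?thesis by (intro zp_congI[of _ _ "of_int c"]) simp_all
qed

section \<open>Units of \<open>Zp p\<close> and Fermat's little theorem\<close>

lemma zp_unit_fraction:
  "zp_unit p (of_int a / of_int b)" if "\<not> int p dvd a" "\<not> int p dvd b"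
  unfolding zp_unit_def Zp_iff[OF p] using that by fastforce

text \<open>If \<open>p\<close> divided the numerator, the fraction would be \<open>p\<close> times
  an element of \<open>Zp p\<close>. This turns the incongruences assumed of \<open>m\<close> into
  invertibility.\<close>

lemma zp_unit_if_not_cong_0:
  assumes "x \<in> Zp p" "\<not> zp_cong p x 0"
  shows "zp_unit p x"
proof -
  obtain a b where ab: "\<not> int p dvd b" "x = of_int a / of_int b"
    using assms(1) unfolding Zp_iff[OF p] by blast
  have "\<not> int p dvd a"
  proof
    assume "int p dvd a"
    then obtain c where c: "a = int p * c" by blast
    have "of_int c / of_int b \<in> Zp p" using ab(1) unfolding Zp_iff[OF p] by blast
    then have "zp_cong p x 0"
      by (intro zp_congI[of _ _ "of_int c / of_int b"]) (use assms ab c in auto)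
    with assms show False by simp
  qed
  then show ?thesis using ab zp_unit_fraction by simp
qed

lemma zp_unit_diff: "zp_unit p (x - y)" if "x \<in> Zp p" "y \<in> Zp p" "\<not> zp_cong p x y"
  using that by (intro zp_unit_if_not_cong_0) (auto simp: zp_cong_def)

lemma zp_unit_mult: "zp_unit p (x * y)" if "zp_unit p x" "zp_unit p y"
  using that by (auto simp: zp_unit_def)

lemma zp_unit_inverse: "zp_unit p (inverse x)" if "zp_unit p x"
  using that by (auto simp: zp_unit_def)

lemma zp_unit_divide: "zp_unit p (x / y)" if "zp_unit p x" "zp_unit p y"
  using zp_unit_mult[OF that(1) zp_unit_inverse[OF that(2)]] by (simp add: divide_inverse)

lemma Zp_divide: "x / y \<in> Zp p" if "x \<in> Zp p" "zp_unit p y"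
  using that by (auto simp: divide_inverse zp_unit_def)

text \<open>Numerator and denominator of a unit are both prime to \<open>p\<close>; the quotient of
  the two integer Fermat congruences is the claim.\<close>

lemma zp_unit_power_p_minus_1:
  assumes "zp_unit p x"
  shows "zp_cong p (x ^ (p - 1)) 1"
proof -
  have fermat: "zp_cong p (of_int a ^ (p - 1)) 1" if "\<not> int p dvd a" for a
  proof -
    define c where "c = nat (a mod int p)"
    have c: "int c = a mod int p" using p by (simp add: c_def prime_gt_0_nat)
    then have "\<not> p dvd c" using that by (metis dvd_mod_iff dvd_refl of_nat_dvd_iff)
    then have "[c ^ (p - 1) = 1] (mod p)" by (rule fermat_theorem[OF p])
    then have "[int (c ^ (p - 1)) = int 1] (mod int p)" by (simp only: cong_int_iff)
    moreover have "[a ^ (p - 1) = int c ^ (p - 1)] (mod int p)"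
      by (intro cong_pow) (simp add: c cong_def)
    ultimately have "[a ^ (p - 1) = 1] (mod int p)" using cong_trans by (simp, blast)
    then show ?thesis using zp_cong_of_int by fastforce
  qed
  obtain a b where ab: "\<not> int p dvd b" "x = of_int a / of_int b"
    using assms unfolding zp_unit_def Zp_iff[OF p] by blast
  obtain a' b' where ab': "\<not> int p dvd b'" "inverse x = of_int a' / of_int b'"
    using assms unfolding zp_unit_def Zp_iff[OF p] by blast
  have "of_int (a * a') = (of_int (b * b') :: rat)"
  proof -
    have "of_int a / of_int b * (of_int a' / of_int b') = (1 :: rat)"
      unfolding ab(2)[symmetric] ab'(2)[symmetric] using assms by (simp add: zp_unit_def)
    moreover have "b \<noteq> 0" "b' \<noteq> 0" using ab(1) ab'(1) by auto
    ultimately show ?thesis by simp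
  qed
  then have "a * a' = b * b'" by (simp only: of_int_eq_iff)
  then have "\<not> int p dvd a"
    using ab(1) ab'(1) p by (metis dvd_mult2 prime_dvd_mult_iff prime_nat_int_transfer)
  then have a: "zp_cong p (of_int a ^ (p - 1)) 1" by (rule fermat)
  have "zp_unit p (of_int b)" using zp_unit_fraction[of b 1] ab(1) p prime_gt_1_nat[OF p] by simp
  then have B: "zp_unit p (of_int b ^ (p - 1))"
    by (auto simp: zp_unit_def simp flip: power_inverse)
  have "zp_cong p (of_int a ^ (p - 1)) (of_int b ^ (p - 1))"
    using a zp_cong_sym[OF fermat[OF ab(1)]] by (rule zp_cong_trans)
  then have "zp_cong p (inverse (of_int b ^ (p - 1)) * of_int a ^ (p - 1)) (inverse (of_int b ^ (p - 1)) * of_int b ^ (p - 1))"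
    using B by (intro zp_cong_mult_left) (auto simp: zp_unit_def)
  then show ?thesis using B ab(2) by (simp add: zp_unit_def power_mult_distrib power_inverse divide_inverse mult.commute)
qed

section \<open>Truncated generating functions modulo a prime\<close>

text \<open>Negating the upper index gives \<open>(-1)^j\<close> times the binomial of
  \<open>-i - 1\<close> over \<open>j\<close>, and \<open>-i - 1\<close> is congruent to
  \<open>p - 1 - i\<close>. The induction uses the absorption identity; \<open>Suc j\<close> can be
  cancelled since it is less than \<open>p\<close>.\<close>

lemma choose_add_cong:
  assumes "i < p" "j < p"
  shows "[int ((i + j) choose j) = (- 1) ^ j * int ((p - 1 - i) choose j)] (mod int p)"
  using assms(2)
proof (induction j)
  case 0
  show ?case by simp
next
  case (Suc j)
  define N where "N = p - 1 - i"
  have N: "int N = int p - 1 - int i" using assms(1) by (simp add: N_def of_nat_diff)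
  have 1: "int (Suc j) * int ((i + Suc j) choose Suc j) = int (i + j + 1) * int ((i + j) choose j)"
    using arg_cong[OF Suc_times_binomial[of j "i + j"], of int]
    by (simp only: of_nat_mult add_Suc_right Suc_eq_plus1 add.assoc)
  have 2: "int (Suc j) * int (N choose Suc j) = (int N - int j) * int (N choose j)"
  proof (cases "j \<le> N")
    case True
    have "Suc j * (N choose Suc j) = (N - j) * (N choose j)"
      by (simp only: binomial_absorption binomial_absorb_comp)
    then have "int (Suc j * (N choose Suc j)) = int ((N - j) * (N choose j))" by (rule arg_cong)
    then show ?thesis using True by (simp add: of_nat_diff algebra_simps)
  qed (simp add: binomial_eq_0)
  have "[int (i + j + 1) * int ((i + j) choose j) = (int j - int N) * ((- 1) ^ j * int (N choose j))] (mod int p)"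
  proof (rule cong_mult)
    show "[int (i + j + 1) = int j - int N] (mod int p)" by (simp add: N cong_iff_dvd_diff)
    show "[int ((i + j) choose j) = (- 1) ^ j * int (N choose j)] (mod int p)"
      using Suc unfolding N_def by simp
  qed
  also have "(int j - int N) * ((- 1) ^ j * int (N choose j)) = (- 1) ^ Suc j * ((int N - int j) * int (N choose j))"
    by (simp add: algebra_simps)
  also have "\<dots> = int (Suc j) * ((- 1) ^ Suc j * int (N choose Suc j))"
    unfolding 2[symmetric] by simp
  finally have "[int (Suc j) * int ((i + Suc j) choose Suc j) = int (Suc j) * ((- 1) ^ Suc j * int (N choose Suc j))] (mod int p)"
    unfolding 1 .
  moreover have "coprime (int (Suc j)) (int p)"
  proof -
    have "\<not> p dvd Suc j" using Suc.prems by (auto dest: dvd_imp_le)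
    then have "coprime p (Suc j)" using p by (intro prime_imp_coprime) auto
    then show ?thesis by (simp only: coprime_int_iff coprime_commute)
  qed
  ultimately show ?case unfolding N_def by (simp only: cong_mult_lcancel)
qed

text \<open>With \<open>n = j + (i - s)\<close> the coefficients become
  \<open>(i + j) choose j\<close>, which modulo \<open>p\<close> are the signed binomials of order
  \<open>p - 1 - i\<close>, so the series turns into a finite binomial expansion.\<close>

lemma zp_cong_sum_choose:
  assumes "i < p" "s \<le> i" "y \<in> Zp p"
  shows "zp_cong p (\<Sum>n<p. of_nat ((n + s) choose i) * y ^ n) (y ^ (i - s) * (1 - y) ^ (p - 1 - i))"
proof -
  define d where "d = i - s"
  have "(\<Sum>n<p. of_nat ((n + s) choose i) * y ^ n) = (\<Sum>n\<in>{d..<p}. of_nat ((n + s) choose i) * y ^ n)"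
    using assms by (intro sum.mono_neutral_right) (auto simp: d_def binomial_eq_0)
  also have "\<dots> = (\<Sum>j<p - d. of_nat ((i + j) choose j) * (y ^ d * y ^ j))"
  proof (intro sum.reindex_bij_witness[of _ "\<lambda>j. j + d" "\<lambda>n. n - d"])
    fix n assume "n \<in> {d..<p}"
    then have *: "n + s = i + (n - d)" "n = d + (n - d)" using assms(2) by (auto simp: d_def)
    have "((i + (n - d)) choose (n - d)) = ((n + s) choose i)"
      using binomial_symmetric[of i "i + (n - d)"] *(1) by simp
    moreover have "y ^ d * y ^ (n - d) = y ^ n" using *(2) by (metis power_add)
    ultimately show "of_nat ((i + (n - d)) choose (n - d)) * (y ^ d * y ^ (n - d)) = of_nat ((n + s) choose i) * y ^ n"
      by simp
  qed auto
  also have "\<dots> = y ^ d * (\<Sum>j<p - d. of_nat ((i + j) choose j) * y ^ j)"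
    by (simp add: sum_distrib_left ac_simps)
  also have "zp_cong p \<dots> (y ^ d * (\<Sum>j<p - d. of_int ((- 1) ^ j * int ((p - 1 - i) choose j)) * y ^ j))"
  proof (intro zp_cong_mult_left zp_cong_sum)
    fix j assume "j \<in> {..<p - d}"
    then have "[int ((i + j) choose j) = (- 1) ^ j * int ((p - 1 - i) choose j)] (mod int p)"
      using choose_add_cong assms(1) by auto
    then have "zp_cong p (of_int (int ((i + j) choose j))) (of_int ((- 1) ^ j * int ((p - 1 - i) choose j)))"
      by (rule zp_cong_of_int)
    then show "zp_cong p (of_nat ((i + j) choose j) * y ^ j) (of_int ((- 1) ^ j * int ((p - 1 - i) choose j)) * y ^ j)"
      using assms(3) by (intro zp_cong_mult zp_cong_refl) auto
  qed (use assms in auto)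
  \<comment> \<open>Since \<open>d \<le> i\<close>, the range \<open>j < p - d\<close> contains the
    whole expansion, and the excess binomials are 0.\<close>
  also have "(\<Sum>j<p - d. of_int ((- 1) ^ j * int ((p - 1 - i) choose j)) * y ^ j)
      = (\<Sum>j\<le>p - 1 - i. of_nat ((p - 1 - i) choose j) * (- y) ^ j * 1 ^ (p - 1 - i - j))"
    using assms(1,2)
    by (intro sum.mono_neutral_cong_right) (auto simp: d_def binomial_eq_0 power_minus[of y])
  also have "\<dots> = (1 - y) ^ (p - 1 - i)"
    using binomial_ring[of "- y" 1 "p - 1 - i"] by simp
  finally show ?thesis by (simp add: d_def)
qed

text \<open>Fermat replaces the exponent \<open>p - 1 - i\<close> by \<open>-i\<close>, so that for
  indices proportional to \<open>k\<close> the result becomes a \<open>k\<close>-th power.\<close>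

lemma zp_cong_sum_choose_unit:
  assumes "i < p" "s \<le> i" "y \<in> Zp p" "zp_unit p (1 - y)"
  shows "zp_cong p (\<Sum>n<p. of_nat ((n + s) choose i) * y ^ n) (y ^ (i - s) / (1 - y) ^ i)"
proof -
  have u: "inverse ((1 - y) ^ i) \<in> Zp p"
    using assms(4) by (auto simp: zp_unit_def simp flip: power_inverse)
  have "zp_cong p (y ^ (i - s) * inverse ((1 - y) ^ i) * (1 - y) ^ (p - 1)) (y ^ (i - s) * inverse ((1 - y) ^ i) * 1)"
    using u assms(3) by (intro zp_cong_mult_left zp_unit_power_p_minus_1 assms(4)) auto
  moreover have "(1 - y) ^ (p - 1) = (1 - y) ^ i * (1 - y) ^ (p - 1 - i)"
    using assms(1) by (simp flip: power_add)
  moreover from this have "inverse ((1 - y) ^ i) * (1 - y) ^ (p - 1) = (1 - y) ^ (p - 1 - i)"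
    using assms(4) by (simp add: zp_unit_def field_simps)
  ultimately have "zp_cong p (y ^ (i - s) * (1 - y) ^ (p - 1 - i)) (y ^ (i - s) / (1 - y) ^ i)"
    by (simp only: mult.assoc divide_inverse mult_1_right)
  then show ?thesis using zp_cong_sum_choose[OF assms(1-3)] zp_cong_trans by blast
qed

text \<open>Exchange the sums and apply the truncated series with \<open>s = 0\<close> at
  \<open>x = 1 / m\<close>. Here \<open>1 - x = (m - 1) / m\<close> is a unit and
  \<open>x / (1 - x) = 1 / (m - 1)\<close>.\<close>

lemma zp_cong_binomial_transform:
  assumes g: "\<And>n. g n = (\<Sum>j\<le>n. of_nat (n choose j) * h j)"
    and h: "\<And>j. h j \<in> Zp p" and m: "zp_unit p m" "zp_unit p (m - 1)"
  shows "zp_cong p (\<Sum>n<p. g n / m ^ n) (\<Sum>j<p. h j * (1 / (m - 1)) ^ j)"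
proof -
  define x where "x = inverse m"
  have x: "x \<in> Zp p" using m by (simp add: x_def zp_unit_def)
  have m0: "m \<noteq> 0" "m - 1 \<noteq> 0" using m by (auto simp: zp_unit_def)
  have x1: "1 - x = (m - 1) / m" using m0 by (simp add: x_def field_simps)
  have "(\<Sum>n<p. g n / m ^ n) = (\<Sum>n<p. \<Sum>j<p. h j * (of_nat (n choose j) * x ^ n))"
  proof (intro sum.cong refl)
    fix n assume "n \<in> {..<p}"
    then have "g n = (\<Sum>j<p. of_nat (n choose j) * h j)"
      unfolding g by (intro sum.mono_neutral_left) (auto simp: binomial_eq_0)
    then have "g n * x ^ n = (\<Sum>j<p. h j * (of_nat (n choose j) * x ^ n))"
      by (simp add: sum_distrib_left ac_simps)
    then show "g n / m ^ n = (\<Sum>j<p. h j * (of_nat (n choose j) * x ^ n))"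
      by (simp add: x_def divide_inverse power_inverse)
  qed
  also have "\<dots> = (\<Sum>j<p. h j * (\<Sum>n<p. of_nat ((n + 0) choose j) * x ^ n))"
    unfolding sum_distrib_left by (subst sum.swap) simp
  also have "zp_cong p \<dots> (\<Sum>j<p. h j * (x ^ (j - 0) / (1 - x) ^ j))"
    using x x1 m by (intro zp_cong_sum zp_cong_mult_left h zp_cong_sum_choose_unit) (auto intro: zp_unit_divide)
  also have "(\<Sum>j<p. h j * (x ^ (j - 0) / (1 - x) ^ j)) = (\<Sum>j<p. h j * (1 / (m - 1)) ^ j)"
  proof -
    have "x / (1 - x) = 1 / (m - 1)" using m0 unfolding x1 by (simp add: x_def)
    then show ?thesis by (simp flip: power_divide)
  qed
  finally show ?thesis .
qed

text \<open>The prime \<open>p\<close> divides \<open>(3k)!\<close> but not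
  \<open>k!\<close>.\<close>

lemma cubic_coeff_dvd: "p dvd cubic_coeff k" if "k < p" "p \<le> 3 * k"
proof -
  have "p dvd cubic_coeff k * fact k ^ 3"
    unfolding cubic_coeff_fact using that p by (simp add: prime_dvd_fact_iff)
  moreover have "\<not> p dvd fact k ^ 3"
    using that p by (meson prime_dvd_power prime_dvd_fact_iff not_le)
  ultimately show ?thesis using p by (simp only: prime_dvd_mult_iff) blast
qed

text \<open>Covers both expansions, with \<open>(s, d, c)\<close> equal to \<open>(1, 2, 2)\<close>
  and \<open>(2, 1, -4)\<close>. The condition \<open>s + d = 3\<close> makes the power of
  \<open>c * z\<close> left by the truncated series cancel \<open>c ^ (d * k)\<close>;
  \<open>d > 0\<close> makes the terms with \<open>k > n\<close> vanish.\<close>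

lemma zp_cong_cubic:
  assumes f: "\<And>n. f n = (\<Sum>k\<le>n. of_nat (cubic_coeff k * ((n + s * k) choose (3 * k))) * (c ^ n / c ^ (d * k)))"
    and sd: "s + d = 3" "d > 0" and c: "zp_unit p c" and z: "z \<in> Zp p" "zp_unit p (1 - c * z)"
  shows "zp_cong p (\<Sum>n<p. f n * z ^ n) (\<Sum>k<p. of_nat (cubic_coeff k) * (z ^ d / (1 - c * z) ^ 3) ^ k)"
proof -
  define y where "y = c * z"
  have y: "y \<in> Zp p" "zp_unit p (1 - y)" using c z by (auto simp: y_def zp_unit_def)
  define A where "A k = of_nat (cubic_coeff k) * inverse (c ^ (d * k))" for k
  have A: "A k \<in> Zp p" for k
    using c unfolding A_def zp_unit_def power_inverse[symmetric] by (intro Zp_mult Zp_power Zp_of_nat) simp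
  have "(\<Sum>n<p. f n * z ^ n) = (\<Sum>n<p. \<Sum>k<p. A k * (of_nat ((n + s * k) choose (3 * k)) * y ^ n))"
  proof (intro sum.cong refl)
    fix n assume n: "n \<in> {..<p}"
    have "(n + s * k) choose (3 * k) = 0" if "n < k" for k
    proof (rule binomial_eq_0)
      have "3 * k = s * k + d * k" using sd(1) by (metis distrib_right)
      moreover have "k \<le> d * k" using sd(2) by simp
      ultimately show "n + s * k < 3 * k" using that by linarith
    qed
    then have "f n = (\<Sum>k<p. of_nat (cubic_coeff k * ((n + s * k) choose (3 * k))) * (c ^ n / c ^ (d * k)))"
      unfolding f using n by (intro sum.mono_neutral_left) auto
    then show "f n * z ^ n = (\<Sum>k<p. A k * (of_nat ((n + s * k) choose (3 * k)) * y ^ n))"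
      by (simp add: sum_distrib_left A_def y_def power_mult_distrib divide_inverse ac_simps)
  qed
  also have "\<dots> = (\<Sum>k<p. A k * (\<Sum>n<p. of_nat ((n + s * k) choose (3 * k)) * y ^ n))"
    unfolding sum_distrib_left by (rule sum.swap)
  also have "zp_cong p \<dots> (\<Sum>k<p. of_nat (cubic_coeff k) * (z ^ d / (1 - c * z) ^ 3) ^ k)"
  proof (rule zp_cong_sum)
    fix k assume "k \<in> {..<p}"
    then have k: "k < p" by simp
    have w: "z ^ d / (1 - c * z) ^ 3 \<in> Zp p"
      using z by (auto simp: zp_unit_def divide_inverse simp flip: power_inverse)
    show "zp_cong p (A k * (\<Sum>n<p. of_nat ((n + s * k) choose (3 * k)) * y ^ n))
        (of_nat (cubic_coeff k) * (z ^ d / (1 - c * z) ^ 3) ^ k)"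
    \<comment> \<open>The truncated series is available only for \<open>3 * k < p\<close>. For the
      remaining \<open>k\<close> the coefficient is divisible by \<open>p\<close>, and both sides
      are congruent to 0.\<close>
    proof (cases "3 * k < p")
      case True
      have "zp_cong p (A k * (\<Sum>n<p. of_nat ((n + s * k) choose (3 * k)) * y ^ n))
          (A k * (y ^ (3 * k - s * k) / (1 - y) ^ (3 * k)))"
        using True sd by (intro zp_cong_mult_left A zp_cong_sum_choose_unit y) auto
      also have "3 * k - s * k = d * k" using sd(1) by (metis add_diff_cancel_left' diff_mult_distrib)
      also have "A k * (y ^ (d * k) / (1 - y) ^ (3 * k)) = of_nat (cubic_coeff k) * (z ^ d / (1 - c * z) ^ 3) ^ k"
        using c by (simp add: A_def y_def zp_unit_def power_mult_distrib power_mult power_divide)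
      finally show ?thesis .
    next
      case False
      then obtain q where q: "cubic_coeff k = p * q" using cubic_coeff_dvd[OF k] by (auto elim: dvdE)
      have "zp_cong p (of_nat (cubic_coeff k)) 0"
        by (rule zp_congI[of _ _ "of_nat q"]) (simp_all only: q of_nat_mult Zp_of_nat Zp_numeral diff_0_right flip: of_nat_mult)
      then have zero: "zp_cong p (of_nat (cubic_coeff k) * v) 0" if "v \<in> Zp p" for v
        using zp_cong_mult[OF _ zp_cong_refl[OF that]] by fastforce
      have "inverse (c ^ (d * k)) \<in> Zp p" using c unfolding zp_unit_def power_inverse[symmetric] by auto
      then have "zp_cong p (A k * (\<Sum>n<p. of_nat ((n + s * k) choose (3 * k)) * y ^ n)) 0"
        unfolding A_def mult.assoc using y by (intro zero Zp_mult Zp_sum Zp_power Zp_of_nat)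
      also have "zp_cong p 0 (of_nat (cubic_coeff k) * (z ^ d / (1 - c * z) ^ 3) ^ k)"
        using w by (intro zp_cong_sym[OF zero]) auto
      finally show ?thesis .
    qed
  qed
  finally show ?thesis .
qed

end

section \<open>Specialisation to \<open>a_seq\<close> and \<open>Q_seq\<close>\<close>

theorem theorem5p1:
  fixes p :: nat and m :: rat
  assumes "prime p" and "odd p"
    and "m \<in> Zp p" and "\<not> zp_cong p m 0" and "\<not> zp_cong p m 1"
  shows
    "(\<not> zp_cong p m 3 \<longrightarrow>
        zp_cong p (\<Sum>k=0..p-1. of_nat (a_seq k) / m ^ k)
          (\<Sum>k=0..p-1. of_nat (((2 * k) choose k) * ((3 * k) choose k))
             / ((m - 3) ^ 3 / (m - 1)) ^ k)) \<and>
     (\<not> zp_cong p m (- 3) \<longrightarrow>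
        zp_cong p (\<Sum>k=0..p-1. of_nat (a_seq k) / m ^ k)
          (\<Sum>k=0..p-1. of_nat (((2 * k) choose k) * ((3 * k) choose k))
             / ((m + 3) ^ 3 / (m - 1)\<^sup>2) ^ k)) \<and>
     (\<not> zp_cong p m (3 / 4) \<longrightarrow>
        zp_cong p (\<Sum>k=0..p-1. of_int (Q_seq k) / (- 8 * m) ^ k)
          (\<Sum>k=0..p-1. of_nat (((2 * k) choose k) * ((3 * k) choose k))
             / ((4 * m - 3) ^ 3 / (m - 1)) ^ k)) \<and>
     (\<not> zp_cong p m (3 / 2) \<longrightarrow>
        zp_cong p (\<Sum>k=0..p-1. of_int (Q_seq k) / (- 8 * m) ^ k)
          (\<Sum>k=0..p-1. of_nat (((2 * k) choose k) * ((3 * k) choose k))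
             / (- ((2 * m - 3) ^ 3) / (m - 1)\<^sup>2) ^ k))"
proof -
  note p = assms(1)
  have range: "{0..p - 1} = {..<p}" using prime_gt_0_nat[OF p] by auto
  \<comment> \<open>Oddness of \<open>p\<close> enters here; 2, -4 and -8 have to be
    invertible.\<close>
  have two: "zp_unit p 2"
  proof -
    have "\<not> p dvd 2" using assms(2) primes_dvd_imp_eq[OF p two_is_prime_nat] by auto
    then have "\<not> int p dvd 2" by (metis int_dvd_int_iff of_nat_numeral)
    then show ?thesis using zp_unit_fraction[OF p, of 2 1] p prime_gt_1_nat[OF p] by simp
  qed
  have unit_numerals: "zp_unit p 4" "zp_unit p 8" "zp_unit p (- 4)" "zp_unit p (- 8)" "zp_unit p (- 1)"
  proof -
    show "zp_unit p (- 1)" by (auto simp: zp_unit_def p)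
    show 4: "zp_unit p 4" using zp_unit_mult[OF p two two] by simp
    show 8: "zp_unit p 8" using zp_unit_mult[OF p two 4] by simp
    show "zp_unit p (- 4)" "zp_unit p (- 8)"
      using zp_unit_mult[OF p \<open>zp_unit p (- 1)\<close>] 4 8 by fastforce+
  qed
  have m: "zp_unit p m" "zp_unit p (m - 1)"
    using zp_unit_diff[OF p assms(3), of 0] zp_unit_diff[OF p assms(3), of 1] assms p by simp_all
  then have m1: "m - 1 \<noteq> 0" by (simp add: zp_unit_def)
  \<comment> \<open>\<open>w\<close> is the base of the powers in the denominators of the theorem;
    it is specified through its reciprocal.\<close>
  have franel_2: "zp_cong p (\<Sum>n<p. of_nat (franel n) * z ^ n) (\<Sum>k<p. of_nat (cubic_coeff k) / w ^ k)"
    if "zp_unit p z" "zp_unit p (1 - 2 * z)" "1 / w = z\<^sup>2 / (1 - 2 * z) ^ 3" for z w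
  proof -
    have "zp_cong p (\<Sum>n<p. of_nat (franel n) * z ^ n) (\<Sum>k<p. of_nat (cubic_coeff k) * (1 / w) ^ k)"
      unfolding that(3)
      by (rule zp_cong_cubic[OF p, of _ 1 2 2]) (use franel_expansion_2 two that in \<open>auto simp: zp_unit_def\<close>)
    then show ?thesis by (simp add: power_divide)
  qed
  have franel_4: "zp_cong p (\<Sum>n<p. of_nat (franel n) * z ^ n) (\<Sum>k<p. of_nat (cubic_coeff k) / w ^ k)"
    if "zp_unit p z" "zp_unit p (1 + 4 * z)" "1 / w = z / (1 + 4 * z) ^ 3" for z w
  proof -
    have "zp_cong p (\<Sum>n<p. of_nat (franel n) * z ^ n)
        (\<Sum>k<p. of_nat (cubic_coeff k) * (z ^ 1 / (1 - (- 4) * z) ^ 3) ^ k)"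
      by (rule zp_cong_cubic[OF p, of _ 2 "- 4" 1])
        (use franel_expansion_4 unit_numerals that in \<open>auto simp: zp_unit_def\<close>)
    then have "zp_cong p (\<Sum>n<p. of_nat (franel n) * z ^ n) (\<Sum>k<p. of_nat (cubic_coeff k) * (1 / w) ^ k)"
      unfolding that(3) by simp
    then show ?thesis by (simp add: power_divide)
  qed
  \<comment> \<open>The points at which the truncated Franel series is evaluated; the extra factor
    -1/8 in \<open>z'\<close> stems from the weights \<open>1 / (- 8) ^ j\<close>.\<close>
  define z where "z = 1 / (m - 1)"
  define z' where "z' = - 1 / (8 * (m - 1))"
  have z'_eq: "z' = inverse (- 8) * inverse (m - 1)"
    using m1 by (simp add: z'_def divide_simps)
  have z: "zp_unit p z" "zp_unit p z'"
    unfolding z'_eq z_def inverse_eq_divide[symmetric]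
    by (intro zp_unit_inverse zp_unit_mult p m unit_numerals)+
  have a_sum: "zp_cong p (\<Sum>k<p. of_nat (a_seq k) / m ^ k) (\<Sum>n<p. of_nat (franel n) * z ^ n)"
    unfolding z_def by (rule zp_cong_binomial_transform[OF p])
      (simp_all add: a_seq_eq_binomial_transform m p)
  have Q_sum: "zp_cong p (\<Sum>k<p. of_int (Q_seq k) / (- 8 * m) ^ k) (\<Sum>n<p. of_nat (franel n) * z' ^ n)"
  proof -
    \<comment> \<open>Division by \<open>(- 8) ^ n\<close> turns the weight
      \<open>(- 8) ^ (n - j)\<close> into one that depends on \<open>j\<close> alone, so an ordinary
      binomial transform appears.\<close>
    have "of_int (Q_seq n) / (- 8) ^ n = (\<Sum>j\<le>n. of_nat (n choose j) * (of_nat (franel j) / (- 8) ^ j :: rat))" for n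
      unfolding Q_seq_def atLeast0AtMost of_int_sum sum_divide_distrib
    proof (intro sum.cong refl)
      fix j assume "j \<in> {..n}"
      then have "(- 8 :: rat) ^ n = (- 8) ^ (n - j) * (- 8) ^ j" by (simp flip: power_add)
      then show "of_int (int (n choose j) * (- 8) ^ (n - j) * int (franel j)) / (- 8) ^ n
          = of_nat (n choose j) * (of_nat (franel j) / (- 8) ^ j :: rat)"
        by simp
    qed
    then have "zp_cong p (\<Sum>k<p. of_int (Q_seq k) / (- 8) ^ k / m ^ k)
        (\<Sum>j<p. of_nat (franel j) / (- 8) ^ j * (1 / (m - 1)) ^ j)"
    proof (intro zp_cong_binomial_transform[OF p] m)
      show "of_nat (franel j) / (- 8) ^ j \<in> Zp p" for j
        using unit_numerals(4) unfolding divide_inverse power_inverse[symmetric] zp_unit_def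
        by (intro Zp_mult Zp_power Zp_of_nat p) simp
    qed
    moreover have "of_int (Q_seq k) / (- 8) ^ k / m ^ k = of_int (Q_seq k) / (- 8 * m) ^ k" for k
      by (simp only: power_mult_distrib divide_divide_eq_left)
    moreover have "of_nat (franel j) / (- 8) ^ j * (1 / (m - 1)) ^ j = of_nat (franel j) * z' ^ j" for j
      by (simp only: z'_eq power_mult_distrib power_inverse divide_inverse mult_1_left mult.assoc)
    ultimately show ?thesis by (simp only:)
  qed
  have three: "(3 / 4 :: rat) \<in> Zp p" "(3 / 2 :: rat) \<in> Zp p"
    using Zp_divide[OF p _ two, of 3] Zp_divide[OF p _ unit_numerals(1), of 3] p by simp_all
  have 1: "zp_cong p (\<Sum>k<p. of_nat (a_seq k) / m ^ k) (\<Sum>k<p. of_nat (cubic_coeff k) / ((m - 3) ^ 3 / (m - 1)) ^ k)"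
    if "\<not> zp_cong p m 3"
  proof (rule zp_cong_trans[OF p a_sum franel_2[OF z(1)]])
    \<comment> \<open>The assumption that \<open>m\<close> is not congruent to 3 makes this a unit;
      the other three cases follow the same pattern.\<close>
    have eq: "1 - 2 * z = (m - 3) / (m - 1)" using m1 by (simp add: z_def field_simps)
    show "zp_unit p (1 - 2 * z)"
      unfolding eq using that assms(3) p by (intro zp_unit_divide zp_unit_diff m) auto
    have frac: "1 / (a ^ 3 / b) = (1 / b)\<^sup>2 / (a / b) ^ 3" if "b \<noteq> 0" for a b :: rat
      using that by (simp add: power_divide power2_eq_square power3_eq_cube)
    show "1 / ((m - 3) ^ 3 / (m - 1)) = z\<^sup>2 / (1 - 2 * z) ^ 3"
      unfolding eq unfolding z_def by (rule frac[OF m1])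
  qed
  have 2: "zp_cong p (\<Sum>k<p. of_nat (a_seq k) / m ^ k) (\<Sum>k<p. of_nat (cubic_coeff k) / ((m + 3) ^ 3 / (m - 1)\<^sup>2) ^ k)"
    if "\<not> zp_cong p m (- 3)"
  proof (rule zp_cong_trans[OF p a_sum franel_4[OF z(1)]])
    \<comment> \<open>The numerator is kept as a difference so that the incongruence with -3 shows
      it to be a unit.\<close>
    have eq: "1 + 4 * z = (m - (- 3)) / (m - 1)" using m1 by (simp add: z_def field_simps)
    show "zp_unit p (1 + 4 * z)"
      unfolding eq using that assms(3) p by (intro zp_unit_divide zp_unit_diff m) auto
    have frac: "1 / (a ^ 3 / b\<^sup>2) = 1 / b / (a / b) ^ 3" if "b \<noteq> 0" for a b :: rat
      using that by (simp add: power_divide power2_eq_square power3_eq_cube)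
    show "1 / ((m + 3) ^ 3 / (m - 1)\<^sup>2) = z / (1 + 4 * z) ^ 3"
      unfolding eq diff_minus_eq_add unfolding z_def by (rule frac[OF m1])
  qed
  have 3: "zp_cong p (\<Sum>k<p. of_int (Q_seq k) / (- 8 * m) ^ k) (\<Sum>k<p. of_nat (cubic_coeff k) / ((4 * m - 3) ^ 3 / (m - 1)) ^ k)"
    if "\<not> zp_cong p m (3 / 4)"
  proof (rule zp_cong_trans[OF p Q_sum franel_2[OF z(2)]])
    \<comment> \<open>Writing \<open>m - 3 / 4\<close> instead of \<open>4 * m - 3\<close> matches
      the hypothesis; the resulting factor \<open>4^3\<close> cancels against \<open>8^2\<close>
      from the square of \<open>z'\<close>.\<close>
    have eq: "1 - 2 * z' = (m - 3 / 4) / (m - 1)" using m1 by (simp add: z'_def field_simps)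
    show "zp_unit p (1 - 2 * z')"
      unfolding eq using that assms(3) p three by (intro zp_unit_divide zp_unit_diff m) auto
    have frac: "1 / (a ^ 3 / b) = (- 1 / (8 * b))\<^sup>2 / (a / 4 / b) ^ 3" if "b \<noteq> 0" for a b :: rat
      using that by (simp add: power_divide power_mult_distrib power2_eq_square power3_eq_cube)
    have "1 / ((4 * m - 3) ^ 3 / (m - 1)) = z'\<^sup>2 / ((4 * m - 3) / 4 / (m - 1)) ^ 3"
      unfolding z'_def by (rule frac[OF m1])
    moreover have "(4 * m - 3) / 4 = m - 3 / 4" by simp
    ultimately show "1 / ((4 * m - 3) ^ 3 / (m - 1)) = z'\<^sup>2 / (1 - 2 * z') ^ 3"
      unfolding eq by (simp only:)
  qed
  have 4: "zp_cong p (\<Sum>k<p. of_int (Q_seq k) / (- 8 * m) ^ k) (\<Sum>k<p. of_nat (cubic_coeff k) / (- ((2 * m - 3) ^ 3) / (m - 1)\<^sup>2) ^ k)"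
    if "\<not> zp_cong p m (3 / 2)"
  proof (rule zp_cong_trans[OF p Q_sum franel_4[OF z(2)]])
    \<comment> \<open>Here the factor \<open>2^3\<close> cancels the 8 in \<open>z'\<close>, whose
      sign accounts for the minus sign in the denominators.\<close>
    have eq: "1 + 4 * z' = (m - 3 / 2) / (m - 1)" using m1 by (simp add: z'_def field_simps)
    show "zp_unit p (1 + 4 * z')"
      unfolding eq using that assms(3) p three by (intro zp_unit_divide zp_unit_diff m) auto
    have frac: "1 / (- (a ^ 3) / b\<^sup>2) = - 1 / (8 * b) / (a / 2 / b) ^ 3" if "b \<noteq> 0" for a b :: rat
      using that by (simp add: power_divide power_mult_distrib power2_eq_square power3_eq_cube)
    have "1 / (- ((2 * m - 3) ^ 3) / (m - 1)\<^sup>2) = z' / ((2 * m - 3) / 2 / (m - 1)) ^ 3"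
      unfolding z'_def by (rule frac[OF m1])
    moreover have "(2 * m - 3) / 2 = m - 3 / 2" by simp
    ultimately show "1 / (- ((2 * m - 3) ^ 3) / (m - 1)\<^sup>2) = z' / (1 + 4 * z') ^ 3"
      unfolding eq by (simp only:)
  qed
  show ?thesis unfolding range using 1 2 3 4 by blast
qed

end
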